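(* Let $\Omega\subset\mathbb{R}^n$ be a bounded domain, let $u\in\mathrm{Lip}_0(\Omega)\setminus\{0\}$ be a minimizer of $R^\infty$ with $\|\nabla u\|_{L^\infty}=1$, and let $d_\Omega(x)=\operatorname{dist}(x,\partial\Omega)$. Then $|u|\le d_\Omega$ and $$\omega_{\max}(u)\subset\omega_{\max}(d_\Omega)=\mathcal{R}_\Omega.$$
   Context: $\mathrm{Lip}_0(\Omega)$: Lipschitz functions on $\overline\Omega$ vanishing on $\partial\Omega$. $R^\infty(u)=\|\nabla u\|_{L^\infty}/\|u\|_\infty$ is the Rayleigh quotient (equal to $+\infty$ on nonzero functions in $C_0(\Omega)\setminus\mathrm{Lip}_0(\Omega)$, where $C_0(\Omega)$ is the space of continuous functions vanishing on $\partial\Omega$); a minimizer attains $\lambda_\infty=\inf R^\infty=1/r_\Omega$ with $r_\Omega=\max_\Omega d_\Omega$. $\omega_{\max}(v)=\{x\in\Omega:|v(x)|=\|v\|_\infty\}$. $\mathcal{R}_\Omega=\arg\max_{x\in\Omega}d_\Omega(x)$ is the high ridge of $\Omega$. *)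

theory Defs
  imports "HOL-Analysis.Analysis" "HOL-Probability.Essential_Supremum"
begin

text \<open>Functions on the closure of \<open>\<Omega>\<close> are total functions whose values outside the closure of
  \<open>\<Omega>\<close> are irrelevant.\<close>

definition C0 :: "(real^'n) set \<Rightarrow> (real^'n \<Rightarrow> real) set" where
  "C0 \<Omega> = {v. continuous_on (closure \<Omega>) v \<and> (\<forall>x\<in>frontier \<Omega>. v x = 0)}"

definition Lip0 :: "(real^'n) set \<Rightarrow> (real^'n \<Rightarrow> real) set" where
  "Lip0 \<Omega> = {v. (\<exists>L. L-lipschitz_on (closure \<Omega>) v) \<and> (\<forall>x\<in>frontier \<Omega>. v x = 0)}"

definition sup_norm :: "(real^'n) set \<Rightarrow> (real^'n \<Rightarrow> real) \<Rightarrow> real" where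
  "sup_norm \<Omega> v = (SUP x\<in>\<Omega>. \<bar>v x\<bar>)"

definition gradient :: "(real^'n \<Rightarrow> real) \<Rightarrow> real^'n \<Rightarrow> real^'n" where
  "gradient v x = (THE D. GDERIV v x :> D)"

text \<open>The gradient of a Lipschitz function is defined almost everywhere (Rademacher), so
  the value chosen here at points of non-differentiability does not affect its essential supremum
  over \<open>\<Omega>\<close>; the value \<open>\<infinity>\<close> agrees with the convention that the Rayleigh quotient is \<open>\<infinity>\<close>
  on non-Lipschitz functions.\<close>

definition grad_norm :: "(real^'n \<Rightarrow> real) \<Rightarrow> real^'n \<Rightarrow> ereal" where
  "grad_norm v x = (if v differentiable (at x) then ereal (norm (gradient v x)) else \<infinity>)"

definition grad_Linf :: "(real^'n) set \<Rightarrow> (real^'n \<Rightarrow> real) \<Rightarrow> ereal" where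
  "grad_Linf \<Omega> v = esssup (lebesgue_on \<Omega>) (grad_norm v)"

text \<open>Only meaningful for functions in \<open>C0 \<Omega>\<close> that are not identically zero on \<open>\<Omega>\<close>.\<close>

definition rayleigh_inf :: "(real^'n) set \<Rightarrow> (real^'n \<Rightarrow> real) \<Rightarrow> ereal" where
  "rayleigh_inf \<Omega> v = (if v \<in> Lip0 \<Omega> then grad_Linf \<Omega> v / ereal (sup_norm \<Omega> v) else \<infinity>)"

definition lambda_inf :: "(real^'n) set \<Rightarrow> ereal" where
  "lambda_inf \<Omega> = (INF v\<in>{v \<in> C0 \<Omega>. \<exists>x\<in>\<Omega>. v x \<noteq> 0}. rayleigh_inf \<Omega> v)"

definition bdist :: "(real^'n) set \<Rightarrow> real^'n \<Rightarrow> real" where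
  "bdist \<Omega> x = infdist x (frontier \<Omega>)"

definition omega_max :: "(real^'n) set \<Rightarrow> (real^'n \<Rightarrow> real) \<Rightarrow> (real^'n) set" where
  "omega_max \<Omega> v = {x \<in> \<Omega>. \<bar>v x\<bar> = sup_norm \<Omega> v}"

definition high_ridge :: "(real^'n) set \<Rightarrow> (real^'n) set" where
  "high_ridge \<Omega> = {x. is_arg_max (bdist \<Omega>) (\<lambda>y. y \<in> \<Omega>) x}"

end

theory Submission
  imports Defs
begin

text \<open>
  Two estimates meet at the inradius \<open>r = sup d\<close>, where \<open>d\<close> is the distance to the boundary.

  From above: let \<open>x \<in> \<Omega>\<close> and let \<open>y\<close> be a boundary point nearest to \<open>x\<close>. The open ball around \<open>x\<close>
  of radius \<open>d x\<close> lies in \<open>\<Omega>\<close>, and on a convex open set a Lipschitz function whose gradient is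
  almost everywhere bounded by 1 is 1-Lipschitz (\<open>lipschitz_on_if_ae_gradient_bound\<close>). As \<open>u\<close> is
  continuous up to \<open>y\<close>, where it vanishes, \<open>\<bar>u x\<bar> \<le> dist x y = d x\<close>. The difficulty is that the
  segment from \<open>x\<close> to \<open>y\<close> is a null set, so that the gradient may exist nowhere on it; one averages
  over parallel segments.

  From below: for each \<open>x \<in> \<Omega>\<close> the tent of height and radius \<open>d x\<close> centred at \<open>x\<close> is a competitor
  in the minimisation with Rayleigh quotient at most \<open>1 / d x\<close>
  (\<open>lambda_inf_le_inverse_bdist\<close>). The minimality of \<open>u\<close>, whose quotient is the inverse of its
  supremum norm, therefore makes that norm at least \<open>d x\<close>, for every \<open>x\<close>. The distance function
  itself would be a competitor too, but its differentiability almost everywhere requires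
  Rademacher's theorem, whereas a tent is visibly smooth off a sphere and a point.

  Consequently, at a point \<open>x\<close> where \<open>\<bar>u\<bar>\<close> is maximal, \<open>d x \<ge> \<bar>u x\<bar> \<ge> d y\<close> for all \<open>y \<in> \<Omega>\<close>, so
  \<open>x\<close> is on the high ridge.
\<close>

section \<open>Gradients of real-valued functions\<close>

lemma has_derivative_imp_GDERIV:
  fixes f :: "'a::euclidean_space \<Rightarrow> real"
  assumes "(f has_derivative f') (at x)"
  shows "GDERIV f x :> adjoint f' 1"
proof -
  have "linear f'"
    using assms has_derivative_linear by blast
  then have "f' = (\<lambda>h. inner h (adjoint f' 1))"
    using adjoint_works[of f' _ 1] by (auto simp: inner_commute)
  then show ?thesis
    using assms unfolding gderiv_def by metis
qed

lemma GDERIV_inj: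
  fixes f :: "'a::euclidean_space \<Rightarrow> real"
  assumes "GDERIV f x :> D" "GDERIV f x :> E"
  shows "D = E"
proof -
  have "(\<lambda>h. inner h D) = (\<lambda>h. inner h E)"
    using assms has_derivative_unique unfolding gderiv_def by blast
  then have "inner h D = inner h E" for h
    by meson
  then show ?thesis
    by (metis inner_commute vector_eq_rdot)
qed

lemma grad_norm_eq:
  assumes "GDERIV v x :> D"
  shows "grad_norm v x = ereal (norm D)"
proof -
  have "gradient v x = D"
    unfolding gradient_def using assms GDERIV_inj[OF _ assms] by (rule the_equality)
  moreover have "v differentiable (at x)"
    using assms unfolding gderiv_def differentiable_def by blast
  ultimately show ?thesis
    by (simp add: grad_norm_def)
qed

lemma grad_norm_leD:
  assumes "grad_norm v x \<le> ereal c"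
  shows "\<exists>D. GDERIV v x :> D \<and> norm D \<le> c"
proof -
  have "v differentiable (at x)"
    using assms by (auto simp: grad_norm_def split: if_splits)
  then obtain D where D: "GDERIV v x :> D"
    unfolding differentiable_def using has_derivative_imp_GDERIV by blast
  with assms show ?thesis
    by (auto simp: grad_norm_eq)
qed

lemma has_real_derivative_along_line:
  fixes u :: "'a::real_inner \<Rightarrow> real"
  assumes "GDERIV u (z + t *\<^sub>R h) :> D"
  shows "((\<lambda>s. u (z + s *\<^sub>R h)) has_real_derivative inner h D) (at t)"
proof -
  have "((\<lambda>s. z + s *\<^sub>R h) has_derivative (\<lambda>s. s *\<^sub>R h)) (at t)"
    by (auto intro!: derivative_eq_intros)
  from has_derivative_compose[OF this assms[unfolded gderiv_def]]
  have "((\<lambda>s. u (z + s *\<^sub>R h)) has_derivative (\<lambda>s. inner (s *\<^sub>R h) D)) (at t)" .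
  moreover have "(\<lambda>s. inner (s *\<^sub>R h) D) = (*) (inner h D)"
    by (simp add: fun_eq_iff mult.commute)
  ultimately show ?thesis
    by (simp add: has_field_derivative_def)
qed

section \<open>Almost everywhere bounds on the gradient\<close>

text \<open>
  The exceptional null set \<open>N\<close> may contain the whole segment from \<open>a\<close> to \<open>b = a + h\<close>. Hence the
  values of \<open>u\<close> along the segment are replaced by \<open>\<Phi> t\<close>, the integral of \<open>z \<mapsto> u (z + t h)\<close> over a
  small box \<open>Q\<close> around \<open>a\<close>. For every single \<open>t\<close> the set of \<open>z\<close> with \<open>z + t h \<in> N\<close> is a translate
  of \<open>N\<close>, so almost all of the integrands are differentiable at \<open>t\<close>. Their difference quotients
  are dominated by the Lipschitz constant, and by dominated convergence \<open>\<Phi>\<close> is differentiable at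
  every \<open>t\<close>, with derivative of modulus at most \<open>c * norm h\<close> times the volume of \<open>Q\<close>. The mean value
  inequality bounds \<open>\<Phi> 1 - \<Phi> 0\<close>, and shrinking \<open>Q\<close> to \<open>a\<close> recovers \<open>u b - u a\<close>.
\<close>

lemma lipschitz_on_if_ae_gradient_bound:
  fixes u :: "'a::euclidean_space \<Rightarrow> real"
  assumes W: "open W" "convex W" and lip: "L-lipschitz_on W u" and N: "negligible N"
    and grad: "\<And>x. x \<in> W - N \<Longrightarrow> \<exists>D. GDERIV u x :> D \<and> norm D \<le> c" and "0 \<le> c"
  shows "c-lipschitz_on W u"
proof (rule lipschitz_onI)
  fix a b assume ab: "a \<in> W" "b \<in> W"
  define h where "h = b - a"
  have "0 \<le> L"
    using lip lipschitz_on_nonneg by blast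
  have lipD: "\<bar>u x - u y\<bar> \<le> L * norm (x - y)" if "x \<in> W" "y \<in> W" for x y
    using lipschitz_onD[OF lip that] by (simp add: dist_norm)
  have cont: "continuous_on W u"
    using lip lipschitz_on_continuous_on by blast
  have bound: "\<bar>u b - u a\<bar> \<le> c * norm h + 2 * L * e" if "0 < e" for e
  proof -
    \<comment> \<open>A box inside \<open>V\<close> has radius at most \<open>e\<close>, and both it and its translate by \<open>h\<close> lie in \<open>W\<close>;
       by convexity so do all the intermediate translates.\<close>
    define V where "V = W \<inter> (\<lambda>z. z + h) -` W \<inter> ball a e"
    have "open V"
      unfolding V_def by (intro open_Int open_vimage W open_ball continuous_intros)
    moreover have "a \<in> V"
      using ab \<open>0 < e\<close> by (simp add: V_def h_def)
    ultimately obtain p q where pq: "cbox p q \<subseteq> V" "a \<in> box p q"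
      by (meson open_contains_cbox)
    define Q where "Q = cbox p q"
    define \<mu> where "\<mu> = measure lborel Q"
    have "\<mu> > 0"
      unfolding \<mu>_def Q_def using pq(2) content_pos_lt_eq box_ne_empty(2) by blast
    have seg: "z + t *\<^sub>R h \<in> W" if "z \<in> Q" "t \<in> {0..1}" for z t
    proof -
      have "(1 - t) *\<^sub>R z + t *\<^sub>R (z + h) \<in> W"
        using that pq(1) \<open>convex W\<close> unfolding Q_def V_def
        by (intro convexD) auto
      then show ?thesis
        by (simp add: algebra_simps)
    qed
    have int: "(\<lambda>z. u (z + t *\<^sub>R h)) integrable_on Q" if "t \<in> {0..1}" for t
      unfolding Q_def
    proof (intro integrable_continuous continuous_on_compose2[OF cont])
      show "(\<lambda>z. z + t *\<^sub>R h) ` cbox p q \<subseteq> W"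
        using seg that unfolding Q_def by blast
    qed (intro continuous_intros)
    define \<Phi> where "\<Phi> t = integral Q (\<lambda>z. u (z + t *\<^sub>R h))" for t
    have der: "\<exists>d. (\<Phi> has_real_derivative d) (at t within {0..1}) \<and> \<bar>d\<bar> \<le> c * norm h * \<mu>"
      if t: "t \<in> {0..1}" for t
    proof -
      define Nt where "Nt = (+) (- (t *\<^sub>R h)) ` N"
      have Nt: "negligible Nt"
        unfolding Nt_def using N negligible_translation by blast
      have good: "z + t *\<^sub>R h \<in> W - N" if "z \<in> Q" "z \<notin> Nt" for z
        using seg t that unfolding Nt_def by force
      define D where "D x = (SOME D. GDERIV u x :> D \<and> norm D \<le> c)" for x
      have D: "GDERIV u x :> D x" "norm (D x) \<le> c" if "x \<in> W - N" for x
        using someI_ex[OF grad[OF that]] unfolding D_def by auto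
      \<comment> \<open>Redefining the integrands to be zero on \<open>Nt\<close> changes no integral and makes the
         convergence hold at every point.\<close>
      define g where "g z = (if z \<in> Nt then 0 else inner h (D (z + t *\<^sub>R h)))" for z
      have lim: "g integrable_on Q \<and> (\<lambda>k. (\<Phi> (X k) - \<Phi> t) / (X k - t)) \<longlonglongrightarrow> integral Q g"
        if X: "\<And>k. X k \<in> {0..1} - {t}" "X \<longlonglongrightarrow> t" for X :: "nat \<Rightarrow> real"
      proof -
        define q where "q k z = (u (z + X k *\<^sub>R h) - u (z + t *\<^sub>R h)) / (X k - t)" for k z
        define f where "f k z = (if z \<in> Nt then 0 else q k z)" for k z
        have qint: "(q k has_integral (\<Phi> (X k) - \<Phi> t) / (X k - t)) Q" for k
          unfolding q_def \<Phi>_def using X(1)[of k] t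
          by (intro has_integral_divide has_integral_diff integrable_integral int) auto
        have fint: "(f k has_integral (\<Phi> (X k) - \<Phi> t) / (X k - t)) Q" for k
          using has_integral_spike[OF Nt _ qint] unfolding f_def by simp
        have le: "norm (f k z) \<le> L * norm h" if "z \<in> Q" for k z
        proof -
          have "\<bar>u (z + X k *\<^sub>R h) - u (z + t *\<^sub>R h)\<bar> \<le> L * norm ((z + X k *\<^sub>R h) - (z + t *\<^sub>R h))"
            using X(1)[of k] t that by (intro lipD seg) auto
          also have "norm ((z + X k *\<^sub>R h) - (z + t *\<^sub>R h)) = \<bar>X k - t\<bar> * norm h"
            by (simp flip: scaleR_diff_left)
          finally have "\<bar>q k z\<bar> \<le> L * norm h"
            using X(1)[of k] by (simp add: q_def field_simps)
          then show ?thesis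
            using \<open>0 \<le> L\<close> by (simp add: f_def)
        qed
        have conv: "(\<lambda>k. f k z) \<longlonglongrightarrow> g z" if "z \<in> Q" for z
        proof (cases "z \<in> Nt")
          case False
          have "((\<lambda>s. u (z + s *\<^sub>R h)) has_real_derivative inner h (D (z + t *\<^sub>R h)))
            (at t within {0..1})"
            using has_real_derivative_along_line[OF D(1)[OF good[OF that False]]]
            by (rule has_field_derivative_at_within)
          then have "(\<lambda>k. q k z) \<longlonglongrightarrow> inner h (D (z + t *\<^sub>R h))"
            using X unfolding has_field_derivative_iff tendsto_at_iff_sequentially q_def comp_def
            by blast
          with False show ?thesis
            by (simp add: f_def g_def)
        qed (simp add: f_def g_def)
        have "integral Q (f k) = (\<Phi> (X k) - \<Phi> t) / (X k - t)" for k
          using fint by (rule integral_unique)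
        moreover have "(\<lambda>z. L * norm h) integrable_on Q"
          unfolding Q_def by (rule integrable_const)
        moreover have "f k integrable_on Q" for k
          using fint by blast
        ultimately show ?thesis
          using dominated_convergence[of f Q "\<lambda>z. L * norm h" g] le conv by simp
      qed
      have "(\<Phi> has_real_derivative integral Q g) (at t within {0..1})"
        unfolding has_field_derivative_iff tendsto_at_iff_sequentially comp_def
        using lim by blast
      moreover have "\<bar>integral Q g\<bar> \<le> c * norm h * \<mu>"
      proof -
        \<comment> \<open>Some sequence has to be supplied to extract the integrability of \<open>g\<close>.\<close>
        obtain X :: "nat \<Rightarrow> real" where "\<And>k. X k \<in> {0..1} - {t}" "X \<longlonglongrightarrow> t"
        proof -
          have "t islimpt {0..1}"
            using t by (intro connected_imp_perfect) (auto simp: connected_Icc)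
          then show ?thesis
            using that unfolding islimpt_sequential by blast
        qed
        then have "(g has_integral integral Q g) (cbox p q)"
          using lim unfolding Q_def by blast
        moreover have "norm (g z) \<le> c * norm h" if "z \<in> cbox p q" for z
        proof (cases "z \<in> Nt")
          case False
          have "\<bar>inner h (D (z + t *\<^sub>R h))\<bar> \<le> norm h * norm (D (z + t *\<^sub>R h))"
            by (rule Cauchy_Schwarz_ineq2)
          also have "\<dots> \<le> norm h * c"
            using D(2) good False that unfolding Q_def by (intro mult_left_mono) auto
          finally show ?thesis
            using False by (simp add: g_def mult.commute)
        qed (use \<open>0 \<le> c\<close> in \<open>simp add: g_def\<close>)
        ultimately have "norm (integral Q g) \<le> c * norm h * measure lborel (cbox p q)"
          using \<open>0 \<le> c\<close> by (intro has_integral_bound) auto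
        then show ?thesis
          by (simp add: \<mu>_def Q_def)
      qed
      ultimately show ?thesis
        by blast
    qed
    then obtain d where d: "\<And>t. t \<in> {0..1} \<Longrightarrow> (\<Phi> has_real_derivative d t) (at t within {0..1})"
      "\<And>t. t \<in> {0..1} \<Longrightarrow> \<bar>d t\<bar> \<le> c * norm h * \<mu>"
      by metis
    \<comment> \<open>\<open>\<Phi> 1 - \<Phi> 0\<close> differs from \<open>(u b - u a) * \<mu>\<close> by at most \<open>2 * L * e * \<mu>\<close>, because both ends
       of each parallel segment are within \<open>e\<close> of \<open>a\<close> and \<open>b\<close>.\<close>
    have incr: "\<bar>\<Phi> 1 - \<Phi> 0\<bar> \<le> c * norm h * \<mu>"
      using field_differentiable_bound[of "{0..1}" \<Phi> d "c * norm h * \<mu>" 1 0] d by simp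
    have "((\<lambda>z. u (z + h) - u z) has_integral \<Phi> 1 - \<Phi> 0) Q"
      using has_integral_diff[OF integrable_integral[OF int[of 1]] integrable_integral[OF int[of 0]]]
      by (simp add: \<Phi>_def)
    then have "((\<lambda>z. (u b - u a) - (u (z + h) - u z)) has_integral (u b - u a) * \<mu> - (\<Phi> 1 - \<Phi> 0)) Q"
      using has_integral_diff[OF has_integral_const[of "u b - u a" p q], of _ "\<Phi> 1 - \<Phi> 0"]
      by (simp add: \<mu>_def Q_def mult.commute)
    moreover have "norm ((u b - u a) - (u (z + h) - u z)) \<le> 2 * L * e" if "z \<in> Q" for z
    proof -
      have z: "z \<in> W" "z + h \<in> W" "norm (a - z) \<le> e"
        using that pq(1) unfolding Q_def V_def by (auto simp: dist_norm)
      have "\<bar>u b - u (z + h)\<bar> \<le> L * norm (a - z)" "\<bar>u a - u z\<bar> \<le> L * norm (a - z)"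
        using lipD[OF ab(2) z(2)] lipD[OF ab(1) z(1)] by (simp_all add: h_def algebra_simps)
      moreover have "L * norm (a - z) \<le> L * e"
        using z(3) \<open>0 \<le> L\<close> by (rule mult_left_mono)
      ultimately show ?thesis
        by simp
    qed
    ultimately have "norm ((u b - u a) * \<mu> - (\<Phi> 1 - \<Phi> 0)) \<le> 2 * L * e * measure lborel (cbox p q)"
      unfolding Q_def using \<open>0 \<le> L\<close> \<open>0 < e\<close> by (intro has_integral_bound) auto
    then have "\<bar>(u b - u a) * \<mu>\<bar> \<le> c * norm h * \<mu> + 2 * L * e * \<mu>"
      using incr by (simp add: \<mu>_def Q_def)
    then have "\<bar>u b - u a\<bar> * \<mu> \<le> (c * norm h + 2 * L * e) * \<mu>"
      using \<open>\<mu> > 0\<close> by (simp add: abs_mult distrib_right)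
    then show ?thesis
      using \<open>\<mu> > 0\<close> by simp
  qed
  have "\<bar>u b - u a\<bar> \<le> c * norm h"
  proof (rule tendsto_lowerbound)
    show "((\<lambda>e. c * norm h + 2 * L * e) \<longlongrightarrow> c * norm h) (at_right 0)"
      by (auto intro!: tendsto_eq_intros)
    show "\<forall>\<^sub>F e in at_right 0. \<bar>u b - u a\<bar> \<le> c * norm h + 2 * L * e"
      using eventually_at_right_less by (rule eventually_mono) (rule bound)
  qed simp
  then show "dist (u a) (u b) \<le> c * dist a b"
    by (simp add: dist_norm h_def norm_minus_commute abs_minus_commute)
qed (fact \<open>0 \<le> c\<close>)

text \<open>
  This rests on the completeness of Lebesgue measure: whatever \<open>f\<close> does on the null set, its
  preimages there are measurable. It is needed because the essential supremum of a function that
  is not measurable is \<open>\<infinity>\<close>, so that an almost everywhere bound alone gives nothing.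
\<close>

lemma borel_measurable_lebesgue_spike:
  fixes f g :: "'a::euclidean_space \<Rightarrow> 'b::topological_space"
  assumes g: "g \<in> borel_measurable lebesgue" and N: "negligible N"
    and eq: "\<And>x. x \<notin> N \<Longrightarrow> f x = g x"
  shows "f \<in> borel_measurable lebesgue"
proof (rule borel_measurableI)
  fix S :: "'b set" assume "open S"
  then have "g -` S \<in> sets lebesgue"
    using measurable_sets[OF g, of S] by simp
  moreover have "negligible (f -` S \<inter> N)"
    using N by (rule negligible_subset) auto
  moreover have split: "f -` S \<inter> space lebesgue = (g -` S - N) \<union> (f -` S \<inter> N)"
    using eq by auto
  ultimately show "f -` S \<inter> space lebesgue \<in> sets lebesgue"
    unfolding split by (metis N negligible_imp_sets sets.Diff sets.Un)
qed

section \<open>Distance to the boundary\<close>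

text \<open>
  Boundedness ensures that the boundary is nonempty; the distance to the empty set is 0 by
  convention.
\<close>

lemma bdist_pos:
  assumes "open \<Omega>" "bounded \<Omega>" "x \<in> \<Omega>"
  shows "0 < bdist \<Omega> x"
proof -
  have "frontier \<Omega> \<noteq> {}"
    using assms by (intro frontier_not_empty) auto
  moreover have "x \<notin> frontier \<Omega>"
    using assms frontier_disjoint_eq by blast
  ultimately show ?thesis
    unfolding bdist_def by (intro infdist_pos_not_in_closed frontier_closed)
qed

text \<open>Being connected, a ball around a point of \<open>\<Omega>\<close> that leaves \<open>\<Omega>\<close> would meet the boundary.\<close>

lemma bdist_ball_subset:
  assumes "x \<in> \<Omega>"
  shows "ball x (bdist \<Omega> x) \<subseteq> \<Omega>"
proof (rule ccontr)
  assume "\<not> ?thesis"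
  moreover from this have "x \<in> ball x (bdist \<Omega> x)"
    by (metis centre_in_ball ball_eq_empty empty_subsetI not_le)
  ultimately have "ball x (bdist \<Omega> x) \<inter> frontier \<Omega> \<noteq> {}"
    using assms by (intro connected_Int_frontier) blast+
  then obtain y where "y \<in> ball x (bdist \<Omega> x)" "y \<in> frontier \<Omega>"
    by blast
  then show False
    using infdist_le[of y "frontier \<Omega>" x] by (simp add: bdist_def)
qed

text \<open>
  Compactness of the closure makes the supremum one of a bounded set; of an unbounded set of reals it
  would be an unspecified value.
\<close>

lemma sup_norm_bounds:
  assumes cont: "continuous_on (closure \<Omega>) v" and "bounded \<Omega>" "x \<in> \<Omega>"
  shows "\<bar>v x\<bar> \<le> sup_norm \<Omega> v"
proof -
  have "bounded (v ` closure \<Omega>)"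
    using assms by (intro compact_imp_bounded compact_continuous_image) auto
  then obtain B where "\<And>x. x \<in> closure \<Omega> \<Longrightarrow> \<bar>v x\<bar> \<le> B"
    by (auto simp: bounded_iff)
  then have "bdd_above ((\<lambda>x. \<bar>v x\<bar>) ` \<Omega>)"
    using closure_subset[of \<Omega>] by (intro bdd_aboveI[of _ B]) auto
  then show ?thesis
    unfolding sup_norm_def using \<open>x \<in> \<Omega>\<close> by (rule cSUP_upper[rotated])
qed

section \<open>Tents as competitors\<close>

definition tent :: "'a::metric_space \<Rightarrow> real \<Rightarrow> 'a \<Rightarrow> real" where
  "tent a r z = max 0 (r - dist z a)"

lemma tent_lipschitz: "1-lipschitz_on S (tent a r)"
proof (rule lipschitz_onI)
  fix x y
  have "dist x a \<le> dist x y + dist y a" "dist y a \<le> dist x y + dist x a"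
    by metric+
  then show "dist (tent a r x) (tent a r y) \<le> 1 * dist x y"
    by (simp add: tent_def dist_real_def)
qed simp

lemma tent_Lip0:
  assumes "x \<in> \<Omega>"
  shows "tent x (bdist \<Omega> x) \<in> Lip0 \<Omega>"
proof -
  have "tent x (bdist \<Omega> x) y = 0" if "y \<in> frontier \<Omega>" for y
    using infdist_le[OF that, of x] by (simp add: bdist_def tent_def dist_commute)
  then show ?thesis
    unfolding Lip0_def using tent_lipschitz by blast
qed

lemma sup_norm_tent:
  assumes "x \<in> \<Omega>" "0 \<le> r"
  shows "sup_norm \<Omega> (tent x r) = r"
proof -
  have "\<bar>tent x r z\<bar> \<le> \<bar>tent x r x\<bar>" for z
    using assms(2) by (auto simp: tent_def max_def)
  then have "sup_norm \<Omega> (tent x r) = \<bar>tent x r x\<bar>"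
    unfolding sup_norm_def using assms(1) by (intro cSup_eq_maximum) auto
  then show ?thesis
    using assms(2) by (simp add: tent_def)
qed

lemma grad_norm_tent:
  assumes "z \<notin> insert a (sphere a r)"
  shows "grad_norm (tent a r) z = indicator (ball a r) z"
proof (cases "z \<in> ball a r")
  case True
  have "GDERIV (\<lambda>w. norm (w - a)) z :> sgn (z - a)"
    using has_derivative_compose[OF has_derivative_diff[OF has_derivative_ident has_derivative_const[of a]]
      has_derivative_norm[of "z - a"]] assms
    by (simp add: gderiv_def)
  then have "GDERIV (\<lambda>w. r - norm (w - a)) z :> - sgn (z - a)"
    using GDERIV_diff[OF GDERIV_const[of r z]] by fastforce
  then have "GDERIV (tent a r) z :> - sgn (z - a)"
    unfolding gderiv_def
    by (rule has_derivative_transform_within_open[of _ _ _ _ "ball a r"])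
       (use True in \<open>auto simp: tent_def dist_norm norm_minus_commute\<close>)
  then show ?thesis
    using grad_norm_eq[of "tent a r" z] True assms by (simp add: norm_sgn one_ereal_def)
next
  case False
  have "GDERIV (tent a r) z :> 0"
    using GDERIV_const[of 0 z] unfolding gderiv_def
    by (rule has_derivative_transform_within_open[of _ _ _ _ "- cball a r"])
       (use False assms in \<open>auto simp: tent_def dist_commute\<close>)
  then show ?thesis
    using grad_norm_eq[of "tent a r" z] False by (simp add: zero_ereal_def)
qed

lemma grad_Linf_tent:
  assumes "open \<Omega>"
  shows "grad_Linf \<Omega> (tent a r) \<le> 1"
proof -
  let ?N = "insert a (sphere a r)"
  have N: "negligible ?N"
    by (simp add: negligible_sphere)
  have "grad_norm (tent a r) \<in> borel_measurable lebesgue"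
    by (rule borel_measurable_lebesgue_spike[OF _ N grad_norm_tent])
       (auto intro!: borel_measurable_indicator)
  then have "grad_norm (tent a r) \<in> borel_measurable (lebesgue_on \<Omega>)"
    by (rule measurable_restrict_space1)
  moreover have "AE z in lebesgue_on \<Omega>. grad_norm (tent a r) z \<le> 1"
  proof -
    have "AE z in lebesgue. z \<notin> ?N"
      using N by (intro AE_not_in) (simp only: negligible_iff_null_sets)
    then have "AE z in lebesgue. grad_norm (tent a r) z \<le> 1"
      by eventually_elim (simp add: grad_norm_tent indicator_def)
    then show ?thesis
      using assms by (subst AE_restrict_space_iff) auto
  qed
  ultimately show ?thesis
    unfolding grad_Linf_def by (rule esssup_I)
qed

lemma lambda_inf_le_inverse_bdist:
  assumes "open \<Omega>" "bounded \<Omega>" "x \<in> \<Omega>"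
  shows "lambda_inf \<Omega> \<le> 1 / ereal (bdist \<Omega> x)"
proof -
  let ?r = "bdist \<Omega> x"
  let ?v = "tent x ?r"
  have r: "0 < ?r"
    using assms by (rule bdist_pos)
  have Lip: "?v \<in> Lip0 \<Omega>"
    using assms(3) by (rule tent_Lip0)
  then have "?v \<in> C0 \<Omega>"
    unfolding Lip0_def C0_def using lipschitz_on_continuous_on by blast
  moreover have "?v x \<noteq> 0"
    using r by (simp add: tent_def)
  ultimately have "lambda_inf \<Omega> \<le> rayleigh_inf \<Omega> ?v"
    unfolding lambda_inf_def using assms(3) by (intro INF_lower) blast
  also have "\<dots> = grad_Linf \<Omega> ?v / ereal ?r"
    using Lip assms(3) r by (simp add: rayleigh_inf_def sup_norm_tent)
  also have "\<dots> \<le> 1 / ereal ?r"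
    using r grad_Linf_tent[OF assms(1)] by (intro ereal_divide_right_mono) auto
  finally show ?thesis .
qed

section \<open>The bound by the distance function\<close>

text \<open>
  The value \<open>\<infinity>\<close> of \<open>grad_norm\<close> at points where \<open>u\<close> is not differentiable means that the bound on the
  essential supremum also yields differentiability almost everywhere. The Lipschitz estimate on the
  open ball extends by continuity to the closed one, which contains the nearest boundary point.
\<close>

lemma abs_le_bdist:
  assumes "open \<Omega>" "bounded \<Omega>" "u \<in> Lip0 \<Omega>" "grad_Linf \<Omega> u \<le> 1" "x \<in> closure \<Omega>"
  shows "\<bar>u x\<bar> \<le> bdist \<Omega> x"
proof (cases "x \<in> \<Omega>")
  case True
  let ?B = "ball x (bdist \<Omega> x)"
  have sub: "?B \<subseteq> \<Omega>"
    using True by (rule bdist_ball_subset)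
  obtain L where L: "L-lipschitz_on (closure \<Omega>) u" and zero: "\<And>y. y \<in> frontier \<Omega> \<Longrightarrow> u y = 0"
    using assms(3) by (auto simp: Lip0_def)
  have r: "0 < bdist \<Omega> x"
    using assms True bdist_pos by blast
  have "AE y in lebesgue_on \<Omega>. grad_norm u y \<le> 1"
    using esssup_AE[of "grad_norm u" "lebesgue_on \<Omega>"]
  proof eventually_elim
    case (elim y)
    then show ?case
      using assms(4) unfolding grad_Linf_def by (rule order_trans)
  qed
  then have "AE y in lebesgue. y \<in> \<Omega> \<longrightarrow> grad_norm u y \<le> 1"
    using assms(1) by (subst (asm) AE_restrict_space_iff) auto
  then obtain N where N: "N \<in> null_sets lebesgue" "{y. \<not> (y \<in> \<Omega> \<longrightarrow> grad_norm u y \<le> 1)} \<subseteq> N"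
    by (auto simp: eventually_ae_filter)
  have "1-lipschitz_on ?B u"
  proof (rule lipschitz_on_if_ae_gradient_bound)
    show "L-lipschitz_on ?B u"
      using L sub closure_subset lipschitz_on_subset by (metis order_trans)
    show "negligible N"
      using N(1) by (simp add: negligible_iff_null_sets)
    fix y assume "y \<in> ?B - N"
    then have "grad_norm u y \<le> ereal 1"
      using sub N(2) by (auto simp: one_ereal_def)
    then show "\<exists>D. GDERIV u y :> D \<and> norm D \<le> 1"
      by (rule grad_norm_leD)
  qed auto
  then have lip: "1-lipschitz_on (closure ?B) u"
    using continuous_on_subset[OF lipschitz_on_continuous_on[OF L] closure_mono[OF sub]]
    by (rule lipschitz_on_closure)
  obtain y where y: "y \<in> frontier \<Omega>" "bdist \<Omega> x = dist x y"
  proof -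
    have "frontier \<Omega> \<noteq> {}"
      using r by (auto simp: bdist_def infdist_def)
    then show ?thesis
      using infdist_attains_inf[of "frontier \<Omega>" x] that unfolding bdist_def by auto
  qed
  have "dist (u x) (u y) \<le> 1 * dist x y"
    using r y(2) by (intro lipschitz_onD[OF lip]) (auto simp: closure_ball)
  then show ?thesis
    using zero[OF y(1)] y(2) by simp
next
  case False
  then have "x \<in> frontier \<Omega>"
    using assms(1,5) by (simp add: frontier_def interior_open)
  then show ?thesis
    using assms(3) by (simp add: Lip0_def bdist_def)
qed

section \<open>Maximum points and the high ridge\<close>

lemma omega_max_bdist_eq_high_ridge:
  assumes "bounded \<Omega>"
  shows "omega_max \<Omega> (bdist \<Omega>) = high_ridge \<Omega>"
proof -
  have abs: "\<bar>bdist \<Omega> y\<bar> = bdist \<Omega> y" for y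
    by (simp add: bdist_def infdist_nonneg)
  have upper: "bdist \<Omega> y \<le> sup_norm \<Omega> (bdist \<Omega>)" if "y \<in> \<Omega>" for y
    using sup_norm_bounds[of \<Omega> "bdist \<Omega>" y] that assms abs
    by (simp add: bdist_def[abs_def] continuous_on_infdist continuous_on_id)
  have least: "sup_norm \<Omega> (bdist \<Omega>) = bdist \<Omega> x"
    if "x \<in> \<Omega>" "\<And>y. y \<in> \<Omega> \<Longrightarrow> bdist \<Omega> y \<le> bdist \<Omega> x" for x
    unfolding sup_norm_def abs using that by (intro cSup_eq_maximum) auto
  have "bdist \<Omega> x = sup_norm \<Omega> (bdist \<Omega>) \<longleftrightarrow> (\<forall>y. y \<in> \<Omega> \<longrightarrow> bdist \<Omega> y \<le> bdist \<Omega> x)"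
    if "x \<in> \<Omega>" for x
    using upper least[OF that] by metis
  then show ?thesis
    unfolding omega_max_def high_ridge_def is_arg_max_linorder abs by blast
qed

theorem proposition3p1:
  fixes \<Omega> :: "(real^'n) set" and u :: "real^'n \<Rightarrow> real"
  assumes "open \<Omega>" and "connected \<Omega>" and "\<Omega> \<noteq> {}" and "bounded \<Omega>"
    and "u \<in> Lip0 \<Omega>" and "\<exists>x\<in>\<Omega>. u x \<noteq> 0"
    and "rayleigh_inf \<Omega> u = lambda_inf \<Omega>"
    and "grad_Linf \<Omega> u = 1"
  shows "(\<forall>x\<in>closure \<Omega>. \<bar>u x\<bar> \<le> bdist \<Omega> x)
    \<and> omega_max \<Omega> u \<subseteq> omega_max \<Omega> (bdist \<Omega>)
    \<and> omega_max \<Omega> (bdist \<Omega>) = high_ridge \<Omega>"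
proof (intro conjI ballI)
  show below: "\<bar>u x\<bar> \<le> bdist \<Omega> x" if "x \<in> closure \<Omega>" for x
    using assms(1,4,5) _ that by (rule abs_le_bdist) (simp add: assms(8))
  show ridge: "omega_max \<Omega> (bdist \<Omega>) = high_ridge \<Omega>"
    using assms(4) by (rule omega_max_bdist_eq_high_ridge)
  have "continuous_on (closure \<Omega>) u"
    using assms(5) lipschitz_on_continuous_on unfolding Lip0_def by blast
  then have norm_pos: "0 < sup_norm \<Omega> u"
    using assms(4,6) sup_norm_bounds by (metis less_le_trans zero_less_abs_iff)
  have bdist_le: "bdist \<Omega> y \<le> sup_norm \<Omega> u" if "y \<in> \<Omega>" for y
  proof -
    have "0 < bdist \<Omega> y"
      using assms(1,4) that by (rule bdist_pos)
    moreover have "1 / ereal (sup_norm \<Omega> u) \<le> 1 / ereal (bdist \<Omega> y)"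
      using lambda_inf_le_inverse_bdist[OF assms(1,4) that] assms(5,7,8)
      by (simp add: rayleigh_inf_def)
    ultimately show ?thesis
      using norm_pos by (simp add: one_ereal_def field_simps)
  qed
  show "omega_max \<Omega> u \<subseteq> omega_max \<Omega> (bdist \<Omega>)"
  proof
    fix x assume "x \<in> omega_max \<Omega> u"
    then have x: "x \<in> \<Omega>" "sup_norm \<Omega> u = \<bar>u x\<bar>"
      by (auto simp: omega_max_def)
    have "bdist \<Omega> y \<le> bdist \<Omega> x" if "y \<in> \<Omega>" for y
    proof -
      have "bdist \<Omega> y \<le> sup_norm \<Omega> u"
        using that by (rule bdist_le)
      also have "\<dots> \<le> bdist \<Omega> x"
        using x below[of x] closure_subset by auto
      finally show ?thesis .
    qed
    then show "x \<in> omega_max \<Omega> (bdist \<Omega>)"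
      using x(1) by (simp add: ridge high_ridge_def is_arg_max_linorder)
  qed
qed

end
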